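(* Let $|q|<1$ and put $u:=h(q)$, $v_3:=h(q^3)$, $v_5:=h(q^5)$. Then: (i) $u^4+(-12v_3-48v_3^2-64v_3^3)u^3+(-6v_3-48v_3^3-30v_3^2)u^2+(-6v_3^2-12v_3^3-v_3)u+v_3^4=0.$ (ii) $(10u^2+80u^4+70u^5+u+40u^3)v_5+(4096u^5+640u^2+70u+5120u^4+2560u^3)v_5^5+(6400u^4+785u^2+80u+3200u^3+5120u^5)v_5^4+(3200u^4+400u^2+1620u^3+40u+2560u^5)v_5^3+(100u^2+10u+785u^4+640u^5+400u^3)v_5^2=v_5^6+u^6.$
   Context: For $|q|<1$ the level 16 modular function $h$ is defined by $$h(q)=q\prod_{j=1}^{\infty}\frac{(1-q^{16j})^2(1-q^{2j})}{(1-q^j)^2(1-q^{8j})}.$$ *)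

theory Defs
  imports "HOL-Analysis.Analysis"
begin

(* The library product starts at index 0, so Suc j is the index j >= 1 of the usual formula.
   The product converges for norm q < 1; the value of h elsewhere has no meaning. *)
definition h :: "complex \<Rightarrow> complex" where
  "h q = q * (\<Prod>j. (1 - q ^ (16 * Suc j))^2 * (1 - q ^ (2 * Suc j))
                   / ((1 - q ^ Suc j)^2 * (1 - q ^ (8 * Suc j))))"

end

theory Submission
  imports Defs
begin

text \<open>
  With \<open>\<phi>(q) = \<Sum>q^(k\<^sup>2)\<close>, the triple product shows \<open>1 + 4 h(q) = \<phi>(q)/\<phi>(-q)\<close>. Let \<open>w\<close>, \<open>v\<close>, \<open>z\<close> be this
  quotient at \<open>q\<close>, \<open>q\<^sup>3\<close>, \<open>q\<^sup>5\<close>. Up to the constants -256 and -4096, the two claims read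
  \<open>(w^4 - 1)(v^4 - 1) = (wv - 1)^4\<close> and \<open>(w - z)^6 = 16wz(w^4 - 1)(z^4 - 1)\<close>. By Jacobi's identity for
  \<open>\<phi>(q)^4 - \<phi>(-q)^4\<close> they follow by taking powers of the weight 1 identities
  \<open>\<phi>(q)\<phi>(q\<^sup>3) - \<phi>(-q)\<phi>(-q\<^sup>3) = 4q\<psi>(q\<^sup>2)\<psi>(q^6)\<close> and
  \<open>\<phi>(q)\<phi>(-q^5) - \<phi>(-q)\<phi>(q^5) = 4q\<Prod>(1 - q^(4j))(1 - q^(20j))\<close>, where \<open>\<psi>(q) = \<Sum>q^(k(k+1)/2)\<close> over \<open>k \<ge> 0\<close>.
  Each of these is a rearrangement of a lattice sum.
\<close>

section \<open>Infinite products and the triple product identity\<close>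

definition euler_prod :: "complex \<Rightarrow> complex" where
  "euler_prod x = (\<Prod>j. 1 - x ^ Suc j)"

lemma abs_convergent_prod_powers:
  fixes x c :: complex
  assumes "norm x < 1" "m > 0"
  shows "abs_convergent_prod (\<lambda>j. 1 + c * x ^ (m * j + k))"
  unfolding abs_convergent_prod_conv_summable
proof -
  have "norm x ^ m < 1"
    using assms by (simp add: power_less_one_iff)
  hence "summable (\<lambda>j. norm c * norm x ^ k * (norm x ^ m) ^ j)"
    by (intro summable_mult summable_geometric) simp
  moreover have "norm (1 + c * x ^ (m * j + k) - 1) = norm c * norm x ^ k * (norm x ^ m) ^ j" for j
    by (simp add: norm_mult norm_power power_add flip: power_mult)
  ultimately show "summable (\<lambda>j. norm (1 + c * x ^ (m * j + k) - 1))"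
    by presburger
qed

lemma convergent_euler_prod:
  fixes x :: complex
  assumes "norm x < 1"
  shows "convergent_prod (\<lambda>j. 1 - x ^ Suc j)"
  using abs_convergent_prod_imp_convergent_prod[OF abs_convergent_prod_powers[of x 1 "-1" 1]] assms
  by simp

lemma has_prod_euler_prod:
  assumes "norm x < 1"
  shows "(\<lambda>j. 1 - x ^ Suc j) has_prod euler_prod x"
  unfolding euler_prod_def using convergent_euler_prod[OF assms] by (rule convergent_prod_has_prod)

lemma one_minus_power_nonzero:
  fixes x :: complex
  assumes "norm x < 1"
  shows "1 - x ^ Suc j \<noteq> 0"
proof
  assume "1 - x ^ Suc j = 0"
  hence "norm x ^ Suc j = 1"
    by (metis norm_one norm_power right_minus_eq)
  moreover have "norm x ^ Suc j < 1"
    using assms by (subst power_less_one_iff) auto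
  ultimately show False
    by simp
qed

lemma euler_prod_nonzero: "norm x < 1 \<Longrightarrow> euler_prod x \<noteq> 0"
  unfolding euler_prod_def
  by (intro prodinf_nonzero convergent_euler_prod one_minus_power_nonzero)

lemma euler_prod_LIMSEQ:
  assumes "norm x < 1"
  shows "(\<lambda>n. \<Prod>j<n. 1 - x ^ Suc j) \<longlonglongrightarrow> euler_prod x"
  using has_prod_imp_tendsto'[OF has_prod_euler_prod[OF assms]] .

lemma norm_power_less_one:
  fixes q :: "'a :: real_normed_div_algebra"
  assumes "norm q < 1" "n > 0"
  shows "norm (q ^ n) < 1"
  using assms by (simp add: norm_power power_less_one_iff)

lemma h_eq:
  assumes "norm q < 1"
  shows "h q = q * (euler_prod (q ^ 16) ^ 2 * euler_prod (q ^ 2) / (euler_prod q ^ 2 * euler_prod (q ^ 8)))"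
proof -
  have P: "(\<lambda>j. 1 - q ^ (m * Suc j)) has_prod euler_prod (q ^ m)" if "m > 0" for m
    using has_prod_euler_prod[OF norm_power_less_one[OF assms that]] by (simp only: power_mult)
  have "(\<lambda>j. (1 - q ^ (16 * Suc j))^2 * (1 - q ^ (2 * Suc j))
             / ((1 - q ^ (1 * Suc j))^2 * (1 - q ^ (8 * Suc j)))) has_prod
        (euler_prod (q ^ 16) ^ 2 * euler_prod (q ^ 2) / (euler_prod (q ^ 1) ^ 2 * euler_prod (q ^ 8)))"
    by (intro has_prod_divide has_prod_mult has_prod_power P) auto
  thus ?thesis
    unfolding h_def by (simp add: has_prod_iff)
qed

section \<open>Convergence of theta series and Jacobi's triple product\<close>

lemma summable_norm_theta_nat:
  fixes x z :: complex
  assumes "norm x < 1"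
  shows "summable (\<lambda>n. norm (z ^ n * x ^ (n\<^sup>2)))"
proof (rule summable_comparison_test_ev)
  \<comment> \<open>The \<open>n\<close>-th term has norm \<open>(norm z * norm x ^ n) ^ n\<close>,
    and the base tends to 0, so a geometric series dominates eventually.\<close>
  have "(\<lambda>n. norm z * norm x ^ n) \<longlonglongrightarrow> norm z * 0"
    using assms by (intro tendsto_intros LIMSEQ_power_zero) auto
  hence "\<forall>\<^sub>F n in sequentially. norm z * norm x ^ n < 1 / 2"
    by (rule order_tendstoD) auto
  thus "\<forall>\<^sub>F n in sequentially. norm (norm (z ^ n * x ^ (n\<^sup>2))) \<le> (1 / 2) ^ n"
  proof eventually_elim
    case (elim n)
    have "norm (z ^ n * x ^ (n\<^sup>2)) = (norm z * norm x ^ n) ^ n"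
      by (simp add: norm_mult norm_power power_mult_distrib power2_eq_square power_mult)
    also have "\<dots> \<le> (1 / 2) ^ n"
      using elim by (intro power_mono) auto
    finally show ?case
      by simp
  qed
qed (auto intro: summable_geometric)

text \<open>Changing the sign of \<open>k\<close> replaces \<open>z\<close> by its inverse, so both
  halves of the series are one-sided.\<close>

lemma summable_theta:
  fixes x z :: complex
  assumes "norm x < 1"
  shows "(\<lambda>k::int. z powi k * x powi (k\<^sup>2)) summable_on UNIV"
proof -
  have nat: "(\<lambda>k::int. z powi k * x powi (k\<^sup>2)) summable_on (range int)" for z
  proof (subst summable_on_reindex)
    have "(\<lambda>n. z ^ n * x ^ (n\<^sup>2)) summable_on UNIV"
      using summable_norm_theta_nat[OF assms] by (rule norm_summable_imp_summable_on)
    thus "(\<lambda>k. z powi k * x powi (k\<^sup>2)) \<circ> int summable_on UNIV"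
      by (simp add: o_def flip: of_nat_power)
  qed auto
  have "(\<lambda>k::int. z powi k * x powi (k\<^sup>2)) summable_on (uminus ` range int)"
  proof (subst summable_on_reindex)
    show "(\<lambda>k. z powi k * x powi (k\<^sup>2)) \<circ> uminus summable_on range int"
      using nat[of "inverse z"] by (simp add: o_def power_int_minus power_int_inverse)
  qed auto
  with nat have "(\<lambda>k::int. z powi k * x powi (k\<^sup>2)) summable_on (range int \<union> uminus ` range int)"
    by (rule summable_on_union)
  also have "range int \<union> uminus ` range int = UNIV"
  proof -
    have "k \<in> range int \<union> uminus ` range int" for k
      by (cases k rule: int_cases2) auto
    thus ?thesis by auto
  qed
  finally show ?thesis .
qed

text \<open>
  Setting the reciprocal to 0 at negative arguments makes the recurrence \<open>inv_poch_rec\<close>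
  hold for all integers, so the finite triple product needs no boundary cases.
\<close>
definition inv_poch :: "complex \<Rightarrow> int \<Rightarrow> complex" where
  "inv_poch x n = (if n < 0 then 0 else inverse (\<Prod>j<nat n. 1 - x ^ Suc j))"

lemma inv_poch_rec:
  assumes "norm x < 1"
  shows "inv_poch x (n - 1) = (1 - x powi n) * inv_poch x n"
proof (cases "n > 0")
  case True
  then obtain m where m: "n = int (Suc m)"
    by (metis pos_int_cases Suc_pred)
  thus ?thesis
    using one_minus_power_nonzero[OF assms, of m]
    by (simp add: inv_poch_def power_int_def nat_add_distrib)
\<comment> \<open>For \<open>n = 0\<close> the factor \<open>1 - x powi n\<close> vanishes; for
  \<open>n < 0\<close> both sides are 0.\<close>
qed (auto simp: inv_poch_def)

text \<open>\<open>c N k\<close> is the Gaussian binomial coefficient of \<open>2 * N\<close> over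
  \<open>N + k\<close> in base \<open>x\<^sup>2\<close>. It is 0 when \<open>k\<close> exceeds
  \<open>N\<close> in absolute value, so only finitely many terms are nonzero.\<close>

lemma has_sum_jacobi_finite:
  fixes x z :: complex
  assumes x: "norm x < 1" "x \<noteq> 0" and z: "z \<noteq> 0"
  defines "c \<equiv> \<lambda>N k. (\<Prod>j<2*N. 1 - (x\<^sup>2) ^ Suc j) * inv_poch (x\<^sup>2) (int N + k) * inv_poch (x\<^sup>2) (int N - k)"
  shows "((\<lambda>k. c N k * (z powi k * x powi (k\<^sup>2))) has_sum
           (\<Prod>j<N. (1 + z * x ^ (2*j+1)) * (1 + x ^ (2*j+1) / z))) UNIV"
proof (induction N)
  case 0
  have "(\<lambda>k. c 0 k * (z powi k * x powi (k\<^sup>2))) = (\<lambda>k. if k = 0 then 1 else 0)"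
    by (auto simp: c_def inv_poch_def fun_eq_iff)
  moreover have "((\<lambda>k::int. if k = 0 then 1 else 0 :: complex) has_sum 1) UNIV"
    by (rule has_sum_finite_neutralI[where B = "{0}"]) auto
  ultimately show ?case
    by simp
next
  case (Suc N)
  define t where "t = (\<lambda>k::int. z powi k * x powi (k\<^sup>2))"
  define S where "S = (\<Prod>j<N. (1 + z * x ^ (2*j+1)) * (1 + x ^ (2*j+1) / z))"
  define y where "y = x ^ (2*N+1)"
  have x2: "norm (x\<^sup>2) < 1"
    using x by (intro norm_power_less_one) auto
  have IH: "((\<lambda>k. c N k * t k) has_sum S) UNIV"
    using Suc.IH by (simp add: t_def S_def)
  have up: "((\<lambda>k. c N (k - 1) * t (k - 1)) has_sum S) UNIV"
    using IH by (rule iffD1[OF has_sum_reindex_bij_witness[of _ "\<lambda>k. k - 1" "\<lambda>k. k + 1"], rotated -1]) auto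
  have down: "((\<lambda>k. c N (k + 1) * t (k + 1)) has_sum S) UNIV"
    using IH by (rule iffD1[OF has_sum_reindex_bij_witness[of _ "\<lambda>k. k + 1" "\<lambda>k. k - 1"], rotated -1]) auto
  \<comment> \<open>The new factor \<open>(1 + z * y) * (1 + y / z)\<close> is expanded; its terms
    in \<open>z\<close> and \<open>1 / z\<close> are paired with the shifted series.\<close>
  have "((\<lambda>k. (1 + y\<^sup>2) * (c N k * t k) + (y * z * (c N (k - 1) * t (k - 1)) + y / z * (c N (k + 1) * t (k + 1))))
          has_sum ((1 + y\<^sup>2) * S + (y * z * S + y / z * S))) UNIV"
    by (intro has_sum_add has_sum_cmult_right IH up down)
  also have "(1 + y\<^sup>2) * S + (y * z * S + y / z * S) = S * ((1 + z * y) * (1 + y / z))"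
    using z by (simp add: field_simps power2_eq_square)
  also have "(\<lambda>k. (1 + y\<^sup>2) * (c N k * t k) + (y * z * (c N (k - 1) * t (k - 1)) + y / z * (c N (k + 1) * t (k + 1))))
           = (\<lambda>k. c (Suc N) k * t k)"
  proof
    fix k :: int
    \<comment> \<open>\<open>I\<close> has the largest indices that occur, so
      \<open>inv_poch_rec\<close> writes every coefficient as a multiple of it without dividing by a
      factor that may vanish.\<close>
    define I where "I = inv_poch (x\<^sup>2) (int N + 1 + k) * inv_poch (x\<^sup>2) (int N + 1 - k)"
    define P where "P = (\<Prod>j<2*N. 1 - (x\<^sup>2) ^ Suc j)"
    define r where "r = x powi k"
    define a where "a = x ^ N"
    have r: "r \<noteq> 0" and a: "a \<noteq> 0"
      using x by (auto simp: r_def a_def)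
    have X: "(x\<^sup>2) powi (int N + i + k) = a\<^sup>2 * (x\<^sup>2) powi i * r\<^sup>2"
            "(x\<^sup>2) powi (int N + i - k) = a\<^sup>2 * (x\<^sup>2) powi i / r\<^sup>2" for i
    proof -
      have "(x\<^sup>2) powi int N = a\<^sup>2" "(x\<^sup>2) powi k = r\<^sup>2"
        by (simp_all add: a_def r_def power_int_power power_int_power' mult.commute flip: power_mult)
      thus "(x\<^sup>2) powi (int N + i + k) = a\<^sup>2 * (x\<^sup>2) powi i * r\<^sup>2"
           "(x\<^sup>2) powi (int N + i - k) = a\<^sup>2 * (x\<^sup>2) powi i / r\<^sup>2"
        using x by (simp_all add: power_int_add power_int_diff)
    qed
    have rec1: "inv_poch (x\<^sup>2) (int N + k) = (1 - a\<^sup>2 * x\<^sup>2 * r\<^sup>2) * inv_poch (x\<^sup>2) (int N + 1 + k)"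
      using inv_poch_rec[OF x2, of "int N + 1 + k"] X[of 1] by (simp add: algebra_simps)
    have rec2: "inv_poch (x\<^sup>2) (int N - k) = (1 - a\<^sup>2 * x\<^sup>2 / r\<^sup>2) * inv_poch (x\<^sup>2) (int N + 1 - k)"
      using inv_poch_rec[OF x2, of "int N + 1 - k"] X[of 1] by (simp add: algebra_simps)
    have rec3: "inv_poch (x\<^sup>2) (int N + (k - 1)) = (1 - a\<^sup>2 * r\<^sup>2) * inv_poch (x\<^sup>2) (int N + k)"
      using inv_poch_rec[OF x2, of "int N + k"] X[of 0] by (simp add: algebra_simps)
    have rec4: "inv_poch (x\<^sup>2) (int N - (k + 1)) = (1 - a\<^sup>2 / r\<^sup>2) * inv_poch (x\<^sup>2) (int N - k)"
      using inv_poch_rec[OF x2, of "int N - k"] X[of 0] by (simp add: algebra_simps)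
    have c0: "c N k = P * ((1 - a\<^sup>2 * x\<^sup>2 * r\<^sup>2) * (1 - a\<^sup>2 * x\<^sup>2 / r\<^sup>2)) * I"
      by (simp add: c_def P_def I_def rec1 rec2)
    have c1: "c N (k - 1) = P * ((1 - a\<^sup>2 * r\<^sup>2) * (1 - a\<^sup>2 * x\<^sup>2 * r\<^sup>2)) * I"
      by (simp add: c_def P_def I_def rec1 rec3) (simp add: algebra_simps)
    have c2: "c N (k + 1) = P * ((1 - a\<^sup>2 / r\<^sup>2) * (1 - a\<^sup>2 * x\<^sup>2 / r\<^sup>2)) * I"
      by (simp add: c_def P_def I_def rec2 rec4) (simp add: algebra_simps)
    have c3: "c (Suc N) k = P * ((1 - a^4 * x\<^sup>2) * (1 - a^4 * x^4)) * I"
    proof -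
      have "(x\<^sup>2) ^ Suc (2 * N) = a^4 * x\<^sup>2" "(x\<^sup>2) ^ Suc (Suc (2 * N)) = a^4 * x^4"
        by (simp_all only: a_def power_mult[symmetric] power_add[symmetric])
          (rule arg_cong[of _ _ "(^) x"], simp)+
      moreover have "2 * Suc N = Suc (Suc (2 * N))"
        by simp
      ultimately show ?thesis
        by (simp only: c_def P_def I_def prod.lessThan_Suc) (simp add: add.commute)
    qed
    have t1: "t (k - 1) = t k * (x / (z * r\<^sup>2))"
    proof -
      have "(k - 1)\<^sup>2 = k\<^sup>2 - 2 * k + 1"
        by (simp add: power2_eq_square algebra_simps)
      hence "x powi ((k - 1)\<^sup>2) = x powi (k\<^sup>2) / r\<^sup>2 * x"
        using x by (simp add: power_int_add power_int_diff r_def power_int_power' mult_ac)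
      thus ?thesis
        using z by (simp add: t_def power_int_diff)
    qed
    have t2: "t (k + 1) = t k * (x * z * r\<^sup>2)"
    proof -
      have "(k + 1)\<^sup>2 = k\<^sup>2 + 2 * k + 1"
        by (simp add: power2_eq_square algebra_simps)
      hence "x powi ((k + 1)\<^sup>2) = x powi (k\<^sup>2) * r\<^sup>2 * x"
        using x by (simp add: power_int_add r_def power_int_power' mult_ac)
      thus ?thesis
        using z by (simp add: t_def power_int_add)
    qed
    have y: "y = a\<^sup>2 * x"
      by (simp add: y_def a_def power_mult mult_ac flip: power_mult)
    show "(1 + y\<^sup>2) * (c N k * t k) + (y * z * (c N (k - 1) * t (k - 1)) + y / z * (c N (k + 1) * t (k + 1)))
          = c (Suc N) k * t k"
      unfolding c0 c1 c2 c3 t1 t2 y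
      using r z by (simp add: divide_simps) algebra
  qed
  finally show ?case
    by (simp add: t_def S_def y_def)
qed

lemma tendsto_inv_poch:
  assumes "norm x < 1" and f: "filterlim f at_top F"
  shows "((\<lambda>N. inv_poch x (f N)) \<longlongrightarrow> inverse (euler_prod x)) F"
proof (rule Lim_transform_eventually)
  have "filterlim (\<lambda>N. nat (f N)) at_top F"
    by (rule filterlim_compose[OF filterlim_nat_sequentially f])
  hence "((\<lambda>N. \<Prod>j<nat (f N). 1 - x ^ Suc j) \<longlongrightarrow> euler_prod x) F"
    by (rule filterlim_compose[OF euler_prod_LIMSEQ[OF assms(1)]])
  thus "((\<lambda>N. inverse (\<Prod>j<nat (f N). 1 - x ^ Suc j)) \<longlongrightarrow> inverse (euler_prod x)) F"
    using euler_prod_nonzero[OF assms(1)] by (rule tendsto_inverse)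
  have "eventually (\<lambda>N. f N \<ge> 0) F"
    using f by (auto simp: filterlim_at_top)
  thus "\<forall>\<^sub>F N in F. inverse (\<Prod>j<nat (f N). 1 - x ^ Suc j) = inv_poch x (f N)"
    by eventually_elim (auto simp: inv_poch_def)
qed

text \<open>Let \<open>N\<close> tend to infinity in the finite form: the coefficients are uniformly
  bounded and tend to \<open>1 / E\<close>, so Tannery's theorem applies. The limit \<open>L\<close>
  is a hypothesis, so that each application can supply its own closed form.\<close>

theorem jacobi_triple_product:
  fixes x z :: complex
  assumes x: "norm x < 1" "x \<noteq> 0" and z: "z \<noteq> 0"
    and L: "(\<lambda>N. \<Prod>j<N. (1 + z * x ^ (2*j+1)) * (1 + x ^ (2*j+1) / z)) \<longlonglongrightarrow> L"
  shows "((\<lambda>k. z powi k * x powi (k\<^sup>2)) has_sum (euler_prod (x\<^sup>2) * L)) UNIV"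
proof -
  define t where "t = (\<lambda>k::int. z powi k * x powi (k\<^sup>2))"
  define P where "P = (\<lambda>n. \<Prod>j<n. 1 - (x\<^sup>2) ^ Suc j)"
  define c where "c = (\<lambda>N k. P (2*N) * inv_poch (x\<^sup>2) (int N + k) * inv_poch (x\<^sup>2) (int N - k))"
  define E where "E = euler_prod (x\<^sup>2)"
  \<comment> \<open>An enumeration of the integers, as Tannery's theorem concerns series over the
    naturals.\<close>
  define d where "d = int_decode"
  have x2: "norm (x\<^sup>2) < 1"
    using x by (intro norm_power_less_one) auto
  have E: "E \<noteq> 0"
    unfolding E_def by (rule euler_prod_nonzero[OF x2])
  have P: "P \<longlonglongrightarrow> E"
    unfolding P_def E_def by (rule euler_prod_LIMSEQ[OF x2])
  have fin: "((\<lambda>k. c N k * t k) has_sum (\<Prod>j<N. (1 + z * x ^ (2*j+1)) * (1 + x ^ (2*j+1) / z))) UNIV" for N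
    unfolding c_def P_def t_def by (rule has_sum_jacobi_finite[OF x z])
  have sums: "(\<lambda>i. f (d i)) sums S" if "(f has_sum S) UNIV" for f :: "int \<Rightarrow> complex" and S
  proof -
    have "((\<lambda>i. f (d i)) has_sum S) UNIV"
      unfolding d_def using that by (subst has_sum_reindex_bij_betw[OF bij_int_decode])
    thus ?thesis
      by (rule has_sum_imp_sums)
  qed
  have t: "t summable_on UNIV"
    unfolding t_def by (rule summable_theta[OF x(1)])
  hence "(\<lambda>k. norm (t k)) summable_on UNIV"
    by (simp add: summable_on_iff_abs_summable_on_complex)
  hence "(\<lambda>i. norm (t (d i))) summable_on UNIV"
    unfolding d_def by (subst summable_on_reindex_bij_betw[OF bij_int_decode])
  hence norm_t: "summable (\<lambda>i. norm (t (d i)))"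
    by (rule summable_on_imp_summable)

  obtain B1 where B1: "norm (P n) \<le> B1" for n
    using convergent_imp_Bseq[OF convergentI[OF P]] by (auto simp: Bseq_def)
  obtain B2 where B2: "norm (inverse (P n)) \<le> B2" "B2 > 0" for n
    using convergent_imp_Bseq[OF convergentI[OF tendsto_inverse[OF P E]]] by (auto simp: Bseq_def)
  have I: "norm (inv_poch (x\<^sup>2) k) \<le> B2" for k
    using B2(1)[of "nat k"] B2(2) by (auto simp: inv_poch_def P_def)
  have cB: "norm (c N k) \<le> B1 * B2 * B2" for N k
    unfolding c_def norm_mult
    using order.trans[OF norm_ge_zero B1] B2(2) by (intro mult_mono B1 I mult_nonneg_nonneg) auto
  have lim_c: "(\<lambda>N. c N k) \<longlonglongrightarrow> 1 / E" for k
  proof -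
    have at_top: "filterlim (\<lambda>N. int N + i) at_top sequentially" for i
      unfolding filterlim_at_top
    proof
      fix Z :: int
      show "\<forall>\<^sub>F N in sequentially. Z \<le> int N + i"
        using eventually_ge_at_top[of "nat (Z - i)"] by eventually_elim auto
    qed
    have "filterlim (\<lambda>N::nat. 2 * N) at_top sequentially"
      by (intro mult_nat_left_at_top) auto
    with at_top[of k] at_top[of "-k"] have "(\<lambda>N. c N k) \<longlonglongrightarrow> E * inverse E * inverse E"
      unfolding c_def E_def diff_conv_add_uminus
      by (intro tendsto_mult tendsto_inv_poch x2 filterlim_compose[OF P[unfolded E_def]])
    thus ?thesis
      using E by (simp add: field_simps)
  qed
  have "(\<lambda>N. \<Sum>i. c N (d i) * t (d i)) \<longlonglongrightarrow> (\<Sum>i. 1 / E * t (d i))"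
  proof (rule conjunct2[OF conjunct2[OF tannerys_theorem]])
    show "(\<lambda>N. c N (d i) * t (d i)) \<longlonglongrightarrow> 1 / E * t (d i)" for i
      by (intro tendsto_intros lim_c)
    show "\<forall>\<^sub>F (i, N) in at_top \<times>\<^sub>F sequentially. norm (c N (d i) * t (d i)) \<le> B1 * B2 * B2 * norm (t (d i))"
      unfolding norm_mult by (intro always_eventually) (auto intro!: mult_right_mono cB)
    show "summable (\<lambda>i. B1 * B2 * B2 * norm (t (d i)))"
      by (intro summable_mult norm_t)
  qed auto
  moreover have "(\<Sum>i. c N (d i) * t (d i)) = (\<Prod>j<N. (1 + z * x ^ (2*j+1)) * (1 + x ^ (2*j+1) / z))" for N
    using sums[OF fin[of N]] by (simp add: sums_iff)
  ultimately have "L = (\<Sum>i. 1 / E * t (d i))"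
    using L LIMSEQ_unique by simp
  also have "\<dots> = 1 / E * (\<Sum>\<^sub>\<infinity>k. t k)"
    using sums[OF has_sum_cmult_right[OF has_sum_infsum[OF t], of "1 / E"]] by (simp only: sums_iff)
  finally have "(\<Sum>\<^sub>\<infinity>k. t k) = E * L"
    using E by simp
  thus ?thesis
    using has_sum_infsum[OF t] by (simp add: t_def E_def)
qed

text \<open>Dividing each block by its last factor will leave the exponents not divisible by
  \<open>m\<close>; this is used with \<open>m = 2\<close> and \<open>m = 3\<close>.\<close>

lemma euler_prod_grouped_LIMSEQ:
  assumes "norm x < 1" "m > 0"
  shows "(\<lambda>N. \<Prod>j<N. \<Prod>i<m. 1 - x ^ Suc (m * j + i)) \<longlonglongrightarrow> euler_prod x"
proof -
  have "(\<Prod>j<N. \<Prod>i<m. 1 - x ^ Suc (m * j + i)) = (\<Prod>j<m*N. 1 - x ^ Suc j)" for N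
  proof (induction N)
    case (Suc N)
    have "(\<Prod>j<m*N+n. 1 - x ^ Suc j) = (\<Prod>j<m*N. 1 - x ^ Suc j) * (\<Prod>i<n. 1 - x ^ Suc (m * N + i))" for n
      by (induction n) (auto simp: mult_ac)
    from this[of m] show ?case
      using Suc by (simp add: add.commute)
  qed auto
  moreover have "filterlim (\<lambda>N. m * N) at_top sequentially"
    using assms by (intro mult_nat_left_at_top) auto
  ultimately show ?thesis
    using filterlim_compose[OF euler_prod_LIMSEQ[OF assms(1)]] by simp
qed

section \<open>Theta functions\<close>

text \<open>
  Summing over all integers makes \<open>psi q\<close> equal to \<open>2 \<psi>(q\<^sup>2)\<close> in Ramanujan's notation, so that
  no fractional powers of \<open>q\<close> occur.
\<close>
definition phi :: "complex \<Rightarrow> complex" where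
  "phi q = (\<Sum>\<^sub>\<infinity>k::int. q powi (k\<^sup>2))"

definition psi :: "complex \<Rightarrow> complex" where
  "psi q = (\<Sum>\<^sub>\<infinity>k::int. q powi (k\<^sup>2 + k))"

lemma has_sum_phi: "norm q < 1 \<Longrightarrow> ((\<lambda>k. q powi (k\<^sup>2)) has_sum phi q) UNIV"
  using summable_theta[of q 1] by (simp add: phi_def)

lemma has_sum_psi:
  assumes "norm q < 1" "q \<noteq> 0"
  shows "((\<lambda>k. q powi (k\<^sup>2 + k)) has_sum psi q) UNIV"
  using summable_theta[of q q] assms by (simp add: psi_def power_int_add mult.commute)

lemma odd_product_LIMSEQ:
  assumes "norm q < 1"
  shows "(\<lambda>N. \<Prod>j<N. 1 - q ^ (2*j+1)) \<longlonglongrightarrow> euler_prod q / euler_prod (q\<^sup>2)"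
proof -
  have q2: "norm (q\<^sup>2) < 1"
    using assms by (intro norm_power_less_one) auto
  have "(\<lambda>N. (\<Prod>j<N. \<Prod>i<2. 1 - q ^ Suc (2 * j + i)) / (\<Prod>j<N. 1 - (q\<^sup>2) ^ Suc j))
          \<longlonglongrightarrow> euler_prod q / euler_prod (q\<^sup>2)"
    by (intro tendsto_divide euler_prod_grouped_LIMSEQ euler_prod_LIMSEQ euler_prod_nonzero assms q2) auto
  moreover have "(\<Prod>j<N. \<Prod>i<2. 1 - q ^ Suc (2 * j + i)) / (\<Prod>j<N. 1 - (q\<^sup>2) ^ Suc j)
                   = (\<Prod>j<N. 1 - q ^ (2*j+1))" for N
  proof -
    have "(\<Prod>i<2. 1 - q ^ Suc (2 * j + i)) / (1 - (q\<^sup>2) ^ Suc j) = 1 - q ^ (2*j+1)" for j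
    proof -
      have "(q\<^sup>2) ^ Suc j = q ^ Suc (2 * j + 1)"
        by (simp only: power_mult[symmetric]) simp
      moreover have "(\<Prod>i<2. 1 - q ^ Suc (2 * j + i)) = (1 - q ^ (2*j+1)) * (1 - q ^ Suc (2 * j + 1))"
        by (simp only: numeral_2_eq_2 prod.lessThan_Suc) simp
      ultimately show ?thesis
        using one_minus_power_nonzero[OF q2, of j] by (simp only:) simp
    qed
    thus ?thesis
      unfolding prod_dividef[symmetric] by (intro prod.cong) auto
  qed
  ultimately show ?thesis
    by simp
qed

text \<open>The triple product at \<open>z = -1\<close>, where both factors give the product over
  odd exponents.\<close>

lemma phi_uminus_eq:
  assumes "norm q < 1" "q \<noteq> 0"
  shows "phi (-q) = euler_prod q ^ 2 / euler_prod (q\<^sup>2)"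
proof -
  have q2: "norm (q\<^sup>2) < 1"
    using assms by (intro norm_power_less_one) auto
  have "((\<lambda>k. (-1) powi k * q powi (k\<^sup>2)) has_sum
          (euler_prod (q\<^sup>2) * (euler_prod q / euler_prod (q\<^sup>2)) ^ 2)) UNIV"
    using tendsto_power[OF odd_product_LIMSEQ[OF assms(1)], of 2] assms
    by (intro jacobi_triple_product) (auto simp: prod.distrib power2_eq_square)
  also have "(\<lambda>k. (-1) powi k * q powi (k\<^sup>2)) = (\<lambda>k. (-q) powi (k\<^sup>2))"
    by (auto simp: fun_eq_iff power_int_minus_left)
  finally have "phi (-q) = euler_prod (q\<^sup>2) * (euler_prod q / euler_prod (q\<^sup>2)) ^ 2"
    using has_sum_phi[of "-q"] assms has_sum_unique by fastforce
  thus ?thesis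
    using euler_prod_nonzero[OF q2] by (simp add: field_simps power2_eq_square)
qed

text \<open>The triple product at \<open>z = q\<close>; its factors \<open>1 + q ^ (2 * j)\<close>
  are quotients of factors of \<open>euler_prod (q ^ 4)\<close> and
  \<open>euler_prod (q\<^sup>2)\<close>.\<close>

lemma psi_eq:
  assumes "norm q < 1" "q \<noteq> 0"
  shows "psi q = 2 * euler_prod (q ^ 4) ^ 2 / euler_prod (q\<^sup>2)"
proof -
  have q2: "norm (q\<^sup>2) < 1" and q4: "norm (q ^ 4) < 1"
    using assms by (auto intro!: norm_power_less_one)
  define Q where "Q = (\<lambda>N. \<Prod>j<N. 1 + (q\<^sup>2) ^ Suc j)"
  have "(\<lambda>N. (\<Prod>j<N. 1 - (q ^ 4) ^ Suc j) / (\<Prod>j<N. 1 - (q\<^sup>2) ^ Suc j))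
            \<longlonglongrightarrow> euler_prod (q ^ 4) / euler_prod (q\<^sup>2)"
    by (intro tendsto_divide euler_prod_LIMSEQ euler_prod_nonzero q2 q4)
  also have "(\<lambda>N. (\<Prod>j<N. 1 - (q ^ 4) ^ Suc j) / (\<Prod>j<N. 1 - (q\<^sup>2) ^ Suc j)) = Q"
  proof
    fix N
    have "(1 - (q ^ 4) ^ Suc j) / (1 - (q\<^sup>2) ^ Suc j) = 1 + (q\<^sup>2) ^ Suc j" for j
    proof -
      have "(q ^ 4) ^ Suc j = ((q\<^sup>2) ^ Suc j) ^ 2"
        by (simp only: power_mult[symmetric]) (rule arg_cong[of _ _ "(^) q"], simp)
      hence "1 - (q ^ 4) ^ Suc j = (1 + (q\<^sup>2) ^ Suc j) * (1 - (q\<^sup>2) ^ Suc j)"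
        by (simp only: power2_eq_square) (simp add: algebra_simps)
      thus ?thesis
        using one_minus_power_nonzero[OF q2, of j] by simp
    qed
    thus "(\<Prod>j<N. 1 - (q ^ 4) ^ Suc j) / (\<Prod>j<N. 1 - (q\<^sup>2) ^ Suc j) = Q N"
      unfolding prod_dividef[symmetric] Q_def by (intro prod.cong) auto
  qed
  finally have Q: "Q \<longlonglongrightarrow> euler_prod (q ^ 4) / euler_prod (q\<^sup>2)" .
  \<comment> \<open>At \<open>j = 0\<close> the second factor is 2, the source of the constant; the
    remaining ones lag one index behind the first factors.\<close>
  have step: "(\<Prod>j<Suc N. (1 + q * q ^ (2*j+1)) * (1 + q ^ (2*j+1) / q)) = 2 * (Q (Suc N) * Q N)" for N
  proof -
    have "(\<Prod>j<N. (1 + q * q ^ (2*j+1))) = Q N" for N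
      unfolding Q_def by (intro prod.cong) (auto simp: power_mult power2_eq_square)
    moreover have "(\<Prod>j<Suc N. (1 + q ^ (2*j+1) / q)) = 2 * Q N"
      unfolding Q_def prod.lessThan_Suc_shift
      using assms by (auto simp: power_mult power2_eq_square intro!: prod.cong)
    ultimately show ?thesis
      by (simp only: prod.distrib mult_ac)
  qed
  have "(\<lambda>N. 2 * (Q (Suc N) * Q N)) \<longlonglongrightarrow> 2 * (euler_prod (q ^ 4) / euler_prod (q\<^sup>2) * (euler_prod (q ^ 4) / euler_prod (q\<^sup>2)))"
    by (intro tendsto_intros Q LIMSEQ_Suc)
  hence "(\<lambda>N. \<Prod>j<N. (1 + q * q ^ (2*j+1)) * (1 + q ^ (2*j+1) / q))
           \<longlonglongrightarrow> 2 * (euler_prod (q ^ 4) / euler_prod (q\<^sup>2) * (euler_prod (q ^ 4) / euler_prod (q\<^sup>2)))"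
    unfolding step[symmetric] by (rule LIMSEQ_imp_Suc)
  hence "((\<lambda>k. q powi k * q powi (k\<^sup>2)) has_sum
          (euler_prod (q\<^sup>2) * (2 * (euler_prod (q ^ 4) / euler_prod (q\<^sup>2) * (euler_prod (q ^ 4) / euler_prod (q\<^sup>2)))))) UNIV"
    using assms by (intro jacobi_triple_product) auto
  also have "(\<lambda>k. q powi k * q powi (k\<^sup>2)) = (\<lambda>k. q powi (k\<^sup>2 + k))"
    using assms by (simp add: power_int_add mult.commute)
  finally show ?thesis
    using has_sum_psi[OF assms] has_sum_unique euler_prod_nonzero[OF q2]
    by (fastforce simp: power2_eq_square)
qed

text \<open>Euler's pentagonal number theorem at \<open>q ^ 4\<close>, from the triple product with
  \<open>x = q ^ 6\<close> and \<open>z = - (q\<^sup>2)\<close>: its factors have exponents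
  \<open>12 * j + 8\<close> and \<open>12 * j + 4\<close>, and \<open>euler_prod (q ^ 12)\<close>
  supplies the rest.\<close>

lemma has_sum_euler_prod:
  assumes "norm q < 1" "q \<noteq> 0"
  shows "((\<lambda>k. (-1) powi k * q powi (6 * k\<^sup>2 + 2 * k)) has_sum euler_prod (q ^ 4)) UNIV"
proof -
  have q4: "norm (q ^ 4) < 1" and q6: "norm (q ^ 6) < 1" and q12: "norm (q ^ 12) < 1"
    using assms by (auto intro!: norm_power_less_one)
  have "(\<lambda>N. (\<Prod>j<N. \<Prod>i<3. 1 - (q ^ 4) ^ Suc (3 * j + i)) / (\<Prod>j<N. 1 - (q ^ 12) ^ Suc j))
          \<longlonglongrightarrow> euler_prod (q ^ 4) / euler_prod (q ^ 12)"
    by (intro tendsto_divide euler_prod_grouped_LIMSEQ euler_prod_LIMSEQ euler_prod_nonzero q4 q12) auto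
  moreover have "(\<Prod>j<N. \<Prod>i<3. 1 - (q ^ 4) ^ Suc (3 * j + i)) / (\<Prod>j<N. 1 - (q ^ 12) ^ Suc j)
                   = (\<Prod>j<N. (1 + (- (q\<^sup>2)) * (q ^ 6) ^ (2*j+1)) * (1 + (q ^ 6) ^ (2*j+1) / (- (q\<^sup>2))))" for N
  proof -
    have "(\<Prod>i<3. 1 - (q ^ 4) ^ Suc (3 * j + i)) / (1 - (q ^ 12) ^ Suc j)
            = (1 + (- (q\<^sup>2)) * (q ^ 6) ^ (2*j+1)) * (1 + (q ^ 6) ^ (2*j+1) / (- (q\<^sup>2)))" for j
    proof -
      have "(q ^ 12) ^ Suc j = (q ^ 4) ^ Suc (3 * j + 2)"
           "q\<^sup>2 * (q ^ 6) ^ (2*j+1) = (q ^ 4) ^ Suc (3 * j + 1)"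
        by (simp_all only: power_mult[symmetric] power_add[symmetric]) (simp_all add: algebra_simps)
      moreover have "(q ^ 6) ^ (2*j+1) / q\<^sup>2 = (q ^ 4) ^ Suc (3 * j)"
      proof -
        have "(q ^ 6) ^ (2*j+1) = (q ^ 4) ^ Suc (3 * j) * q\<^sup>2"
          by (simp only: power_mult[symmetric] power_add[symmetric]) (simp add: algebra_simps)
        thus ?thesis
          using assms by simp
      qed
      moreover have "1 - (q ^ 4) ^ Suc (3 * j + 2) \<noteq> 0"
        by (rule one_minus_power_nonzero[OF q4])
      moreover have "(\<Prod>i<3. 1 - (q ^ 4) ^ Suc (3 * j + i)) =
         (1 - (q ^ 4) ^ Suc (3 * j)) * (1 - (q ^ 4) ^ Suc (3 * j + 1)) * (1 - (q ^ 4) ^ Suc (3 * j + 2))"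
        by (simp only: numeral_3_eq_3 prod.lessThan_Suc) (simp add: numeral_2_eq_2)
      ultimately show ?thesis
        by (simp only: divide_minus_right mult_minus_left) (simp add: mult.commute)
    qed
    thus ?thesis
      unfolding prod_dividef[symmetric] by (intro prod.cong) auto
  qed
  ultimately have "((\<lambda>k. (- (q\<^sup>2)) powi k * (q ^ 6) powi (k\<^sup>2)) has_sum
        (euler_prod ((q ^ 6)\<^sup>2) * (euler_prod (q ^ 4) / euler_prod (q ^ 12)))) UNIV"
    using assms q6 by (intro jacobi_triple_product) auto
  also have "euler_prod ((q ^ 6)\<^sup>2) * (euler_prod (q ^ 4) / euler_prod (q ^ 12)) = euler_prod (q ^ 4)"
    using euler_prod_nonzero[OF q12] by (simp flip: power_mult)
  also have "(\<lambda>k. (- (q\<^sup>2)) powi k * (q ^ 6) powi (k\<^sup>2)) = (\<lambda>k. (-1) powi k * q powi (6 * k\<^sup>2 + 2 * k))"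
    using assms by (auto simp: fun_eq_iff power_int_add power_int_power power_int_minus_left)
  finally show ?thesis .
qed

section \<open>Double series and their splitting by parity\<close>

lemma has_sum_times_complex:
  fixes f :: "'a \<Rightarrow> complex" and g :: "'b \<Rightarrow> complex"
  assumes f: "(f has_sum a) A" and g: "(g has_sum b) B"
  shows "((\<lambda>(x, y). f x * g y) has_sum (a * b)) (A \<times> B)"
proof (rule has_sum_SigmaI)
  show "((\<lambda>y. case (x, y) of (x, y) \<Rightarrow> f x * g y) has_sum (f x * b)) B" for x
    using has_sum_cmult_right[OF g, of "f x"] by simp
  show "((\<lambda>x. f x * b) has_sum a * b) A"
    by (rule has_sum_cmult_left[OF f])
  have "(\<lambda>x. norm (f x)) summable_on A" "(\<lambda>y. norm (g y)) summable_on B"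
    using f g by (auto simp: summable_on_iff_abs_summable_on_complex[symmetric] dest: has_sum_imp_summable)
  then obtain b' where b': "((\<lambda>y. norm (g y)) has_sum b') B"
    and fA: "(\<lambda>x. norm (f x)) summable_on A"
    by (auto simp: summable_on_def)
  \<comment> \<open>For nonnegative terms, convergence of the iterated sums suffices.\<close>
  have "(\<lambda>(x, y). norm (f x) * norm (g y)) summable_on A \<times> B"
  proof (rule summable_on_SigmaI)
    show "((\<lambda>y. case (x, y) of (x, y) \<Rightarrow> norm (f x) * norm (g y)) has_sum (norm (f x) * b')) B" for x
      using has_sum_cmult_right[OF b', of "norm (f x)"] by simp
    show "(\<lambda>x. norm (f x) * b') summable_on A"
      by (intro summable_on_cmult_left fA)
  qed auto
  thus "(\<lambda>(x, y). f x * g y) summable_on A \<times> B"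
    unfolding summable_on_iff_abs_summable_on_complex by (simp add: case_prod_unfold norm_mult)
qed

lemma has_sum_diff:
  fixes f g :: "'a \<Rightarrow> 'b :: topological_ab_group_add"
  assumes "(f has_sum a) A" "(g has_sum b) A"
  shows "((\<lambda>x. f x - g x) has_sum (a - b)) A"
  using has_sum_add[OF assms(1), of "\<lambda>x. - g x" "- b"] assms(2) by (simp add: has_sum_uminus)

lemma has_sum_split:
  fixes f :: "'a \<Rightarrow> complex"
  assumes "(f has_sum S) UNIV"
  shows "S = infsum f {x. P x} + infsum f {x. \<not> P x}"
proof -
  have "f summable_on B" for B
    using assms by (meson has_sum_imp_summable subset_UNIV summable_on_subset_banach)
  hence "infsum f ({x. P x} \<union> {x. \<not> P x}) = infsum f {x. P x} + infsum f {x. \<not> P x}"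
    by (intro infsum_Un_disjoint) auto
  moreover have "{x. P x} \<union> {x. \<not> P x} = UNIV"
    by auto
  ultimately show ?thesis
    using assms infsumI by fastforce
qed

lemma infsum_even:
  fixes f :: "int \<times> int \<Rightarrow> complex"
  shows "infsum f {p. even (fst p + snd p)} = (\<Sum>\<^sub>\<infinity>(u,v). f (u + v, u - v))"
proof -
  have *: "(m + n) div 2 + (m - n) div 2 = m" "(m + n) div 2 - (m - n) div 2 = n"
    if "even (m + n)" for m n :: int
    using that by presburger+
  show ?thesis
    by (rule infsum_reindex_bij_witness
          [of _ "\<lambda>(u,v). (u + v, u - v)" "\<lambda>(m,n). ((m + n) div 2, (m - n) div 2)"])
       (auto simp: * simp del: even_add)
qed

text \<open>Keeping \<open>n\<close> as a coordinate suits the forms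
  \<open>m\<^sup>2 + 3 * n\<^sup>2\<close> and \<open>m\<^sup>2 + 5 * n\<^sup>2\<close>; the variant
  \<open>infsum_odd'\<close> suits \<open>m\<^sup>2 + n\<^sup>2\<close>.\<close>

lemma infsum_odd:
  fixes f :: "int \<times> int \<Rightarrow> complex"
  shows "infsum f {p. odd (fst p + snd p)} = (\<Sum>\<^sub>\<infinity>(j,n). f (2 * j + 1 - n, n))"
  by (rule infsum_reindex_bij_witness
        [of _ "\<lambda>(j,n). (2 * j + 1 - n, n)" "\<lambda>(m,n). ((m + n) div 2, n)"])
     (auto elim!: oddE simp: algebra_simps)

lemma infsum_odd':
  fixes f :: "int \<times> int \<Rightarrow> complex"
  shows "infsum f {p. odd (fst p + snd p)} = (\<Sum>\<^sub>\<infinity>(u,v). f (u + v + 1, u - v))"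
  unfolding infsum_odd
  by (rule infsum_reindex_bij_witness[of _ "\<lambda>(u,v). (u, u - v)" "\<lambda>(u,v). (u, u - v)"])
     (auto simp: algebra_simps)

lemma has_sum_phi_mult:
  assumes "norm x < 1" "norm y < 1"
  shows "((\<lambda>(m,n). x powi (m\<^sup>2) * y powi (n\<^sup>2)) has_sum (phi x * phi y)) UNIV"
  using has_sum_times_complex[OF has_sum_phi has_sum_phi, OF assms] by simp

lemma has_sum_psi_mult:
  assumes "norm x < 1" "x \<noteq> 0" "norm y < 1" "y \<noteq> 0"
  shows "((\<lambda>(m,n). x powi (m\<^sup>2 + m) * y powi (n\<^sup>2 + n)) has_sum (psi x * psi y)) UNIV"
  using has_sum_times_complex[OF has_sum_psi[OF assms(1,2)] has_sum_psi[OF assms(3,4)]] by simp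

section \<open>Theta function identities from lattice sums\<close>

text \<open>In the coordinates \<open>u\<close>, \<open>v\<close> the form
  \<open>m\<^sup>2 + n\<^sup>2\<close> is diagonal; the pairs with even and odd \<open>m + n\<close>
  give the two terms.\<close>

lemma phi_squared:
  assumes q: "norm q < 1" "q \<noteq> 0"
  shows "phi q ^ 2 = phi (q\<^sup>2) ^ 2 + q * psi (q\<^sup>2) ^ 2"
proof -
  have q2: "norm (q\<^sup>2) < 1" "q\<^sup>2 \<noteq> 0"
    using q by (auto intro!: norm_power_less_one)
  have "phi q ^ 2 = (\<Sum>\<^sub>\<infinity>(u,v). q powi ((u + v)\<^sup>2) * q powi ((u - v)\<^sup>2))
          + (\<Sum>\<^sub>\<infinity>(u,v). q powi ((u + v + 1)\<^sup>2) * q powi ((u - v)\<^sup>2))"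
    using has_sum_split[OF has_sum_phi_mult[OF q(1) q(1)], of "\<lambda>p. even (fst p + snd p)"]
    unfolding infsum_even infsum_odd' by (simp add: power2_eq_square[of "phi q"])
  also have "(\<lambda>(u,v). q powi ((u + v)\<^sup>2) * q powi ((u - v)\<^sup>2))
           = (\<lambda>(u,v). (q\<^sup>2) powi (u\<^sup>2) * (q\<^sup>2) powi (v\<^sup>2))"
    using q by (simp add: fun_eq_iff power_int_power flip: power_int_add)
      (simp add: power2_eq_square algebra_simps)
  also have "(\<lambda>(u,v). q powi ((u + v + 1)\<^sup>2) * q powi ((u - v)\<^sup>2))
           = (\<lambda>(u,v). q * (case (u,v) of (u,v) \<Rightarrow> (q\<^sup>2) powi (u\<^sup>2 + u) * (q\<^sup>2) powi (v\<^sup>2 + v)))"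
    using q by (simp add: fun_eq_iff power_int_power flip: power_int_add power_int_add_1')
      (simp add: power2_eq_square algebra_simps)
  also have "infsum \<dots> UNIV = q * (psi (q\<^sup>2) * psi (q\<^sup>2))"
    using has_sum_cmult_right[OF has_sum_psi_mult[OF q2 q2], of q]
    by (intro infsumI) (simp add: case_prod_unfold)
  also have "(\<Sum>\<^sub>\<infinity>(u,v). (q\<^sup>2) powi (u\<^sup>2) * (q\<^sup>2) powi (v\<^sup>2)) = phi (q\<^sup>2) * phi (q\<^sup>2)"
    by (intro infsumI has_sum_phi_mult q2)
  finally show ?thesis
    by (simp add: power2_eq_square)
qed

text \<open>The reflection of \<open>n\<close> to \<open>-1 - n\<close> preserves
  \<open>n\<^sup>2 + n\<close> and flips its parity class, so both halves agree; hence the factor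
  2.\<close>

lemma psi_squared:
  assumes q: "norm q < 1" "q \<noteq> 0"
  shows "psi q ^ 2 = 2 * phi (q\<^sup>2) * psi (q\<^sup>2)"
proof -
  have q2: "norm (q\<^sup>2) < 1" "q\<^sup>2 \<noteq> 0"
    using q by (auto intro!: norm_power_less_one)
  define f where "f = (\<lambda>(m::int,n::int). q powi (m\<^sup>2 + m) * q powi (n\<^sup>2 + n))"
  have "infsum f {p. \<not> even (fst p + snd p)} = infsum f {p. even (fst p + snd p)}"
    by (rule infsum_reindex_bij_witness[of _ "\<lambda>(m,n). (m, -1 - n)" "\<lambda>(m,n). (m, -1 - n)"])
       (auto simp: f_def power2_eq_square algebra_simps)
  moreover have "infsum f {p. even (fst p + snd p)} = phi (q\<^sup>2) * psi (q\<^sup>2)"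
  proof -
    have "infsum f {p. even (fst p + snd p)} = (\<Sum>\<^sub>\<infinity>(u,v). f (v + u, v - u))"
      unfolding infsum_even
      by (rule infsum_reindex_bij_witness[of _ prod.swap prod.swap]) auto
    also have "(\<lambda>(u,v). f (v + u, v - u)) = (\<lambda>(u,v). (q\<^sup>2) powi (u\<^sup>2) * (q\<^sup>2) powi (v\<^sup>2 + v))"
      using q by (simp add: f_def fun_eq_iff power_int_power flip: power_int_add)
        (simp add: power2_eq_square algebra_simps)
    also have "infsum \<dots> UNIV = phi (q\<^sup>2) * psi (q\<^sup>2)"
      using has_sum_times_complex[OF has_sum_phi[OF q2(1)] has_sum_psi[OF q2]] by (simp add: infsumI)
    finally show ?thesis .
  qed
  ultimately show ?thesis
    using has_sum_split[OF has_sum_psi_mult[OF q q], of "\<lambda>p. even (fst p + snd p)"]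
    by (simp add: f_def power2_eq_square[of "psi q"])
qed

text \<open>By \<open>phi_squared\<close> at \<open>q\<close> and \<open>-q\<close>, the sum and the
  difference of the squares are \<open>2 * phi (q\<^sup>2) ^ 2\<close> and
  \<open>2 * q * psi (q\<^sup>2) ^ 2\<close>; \<open>psi_squared\<close> absorbs their
  product.\<close>

lemma phi_fourth_power_diff:
  assumes q: "norm q < 1" "q \<noteq> 0"
  shows "phi q ^ 4 - phi (-q) ^ 4 = q * psi q ^ 4"
proof -
  have "phi q ^ 4 - phi (-q) ^ 4 = (phi q ^ 2 + phi (-q) ^ 2) * (phi q ^ 2 - phi (-q) ^ 2)"
    by (simp add: algebra_simps power4_eq_xxxx power2_eq_square)
  also have "\<dots> = q * (2 * phi (q\<^sup>2) * psi (q\<^sup>2)) ^ 2"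
  proof -
    have "phi q ^ 2 = phi (q\<^sup>2) ^ 2 + q * psi (q\<^sup>2) ^ 2" "phi (-q) ^ 2 = phi (q\<^sup>2) ^ 2 - q * psi (q\<^sup>2) ^ 2"
      using phi_squared[of q] phi_squared[of "-q"] q by simp_all
    thus ?thesis
      by (simp only:) (simp add: power2_eq_square)
  qed
  also have "\<dots> = q * psi q ^ 4"
    by (simp flip: psi_squared[OF q])
  finally show ?thesis .
qed

text \<open>Swapping \<open>m\<close> and \<open>n\<close> changes the sign of each term with
  \<open>m + n\<close> odd, so only the even half remains.\<close>

lemma phi_times_phi_uminus:
  assumes q: "norm q < 1" "q \<noteq> 0"
  shows "phi q * phi (-q) = phi (-(q\<^sup>2)) ^ 2"
proof -
  have q2: "norm (q\<^sup>2) < 1" "q\<^sup>2 \<noteq> 0"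
    using q by (auto intro!: norm_power_less_one)
  define f where "f = (\<lambda>(m::int,n::int). q powi (m\<^sup>2) * (-q) powi (n\<^sup>2))"
  have "infsum f {p. \<not> even (fst p + snd p)} = (\<Sum>\<^sub>\<infinity>p\<in>{p. \<not> even (fst p + snd p)}. - f p)"
    by (rule infsum_reindex_bij_witness[of _ prod.swap prod.swap])
       (auto simp: f_def power_int_minus_left)
  hence "infsum f {p. \<not> even (fst p + snd p)} = 0"
    by (simp add: infsum_uminus)
  moreover have "infsum f {p. even (fst p + snd p)} = phi (-(q\<^sup>2)) * phi (-(q\<^sup>2))"
  proof -
    have "(\<lambda>(u,v). f (u + v, u - v)) = (\<lambda>(u,v). (-(q\<^sup>2)) powi (u\<^sup>2) * (-(q\<^sup>2)) powi (v\<^sup>2))"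
    proof -
      have "q powi ((u + v)\<^sup>2) * q powi ((u - v)\<^sup>2) = (q\<^sup>2) powi (u\<^sup>2) * (q\<^sup>2) powi (v\<^sup>2)" for u v
        using q by (simp add: power_int_power flip: power_int_add)
          (simp add: power2_eq_square algebra_simps)
      thus ?thesis
        by (auto simp: f_def fun_eq_iff power_int_minus_left)
    qed
    thus ?thesis
      unfolding infsum_even using has_sum_phi_mult[of "-(q\<^sup>2)" "-(q\<^sup>2)"] q2 by (simp add: infsumI)
  qed
  ultimately show ?thesis
    using has_sum_split[OF has_sum_phi_mult[of q "-q"], of "\<lambda>p. even (fst p + snd p)"] q
    by (simp add: f_def power2_eq_square)
qed

text \<open>Only odd indices survive, and
  \<open>(2 * k + 1)\<^sup>2 = 4 * (k\<^sup>2 + k) + 1\<close>.\<close>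

lemma phi_minus_phi_uminus:
  assumes q: "norm q < 1" "q \<noteq> 0"
  shows "phi q - phi (-q) = 2 * q * psi (q ^ 4)"
proof -
  have q4: "norm (q ^ 4) < 1" "q ^ 4 \<noteq> 0"
    using q by (auto intro!: norm_power_less_one)
  define f where "f = (\<lambda>k::int. q powi (k\<^sup>2) - (-q) powi (k\<^sup>2))"
  have "(f has_sum (phi q - phi (-q))) UNIV"
    using has_sum_diff[OF has_sum_phi[of q] has_sum_phi[of "-q"]] q
    unfolding f_def by simp
  hence "phi q - phi (-q) = infsum f {k. even k} + infsum f {k. odd k}"
    by (rule has_sum_split)
  also have "infsum f {k. even k} = 0"
    by (intro infsum_0) (auto simp: f_def)
  also have "infsum f {k. odd k} = (\<Sum>\<^sub>\<infinity>k. f (2 * k + 1))"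
    by (rule infsum_reindex_bij_witness[of _ "\<lambda>k. 2 * k + 1" "\<lambda>k. k div 2"]) auto
  also have "(\<lambda>k. f (2 * k + 1)) = (\<lambda>k. 2 * q * (q ^ 4) powi (k\<^sup>2 + k))"
    using q by (simp add: f_def fun_eq_iff power_int_power flip: power_int_add_1')
      (simp add: power2_eq_square algebra_simps)
  also have "infsum \<dots> UNIV = 2 * q * psi (q ^ 4)"
    by (intro infsumI has_sum_cmult_right has_sum_psi q4)
  finally show ?thesis
    by simp
qed

text \<open>
  The substitution is multiplication by a sixth root of unity in the Eisenstein integers: with
  \<open>m = 2j + 1 - n\<close> it carries \<open>m + n\<surd>-3\<close>, \<open>m + n\<close> odd, to \<open>(k + 1/2) + (l + 1/2)\<surd>-3\<close>, \<open>k + l\<close> odd.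
\<close>
lemma phi_psi_degree_3:
  assumes q: "norm q < 1" "q \<noteq> 0"
  shows "phi q * phi (q ^ 3) - phi (-q) * phi (-(q ^ 3)) = q * psi q * psi (q ^ 3)"
proof -
  have q3: "norm (q ^ 3) < 1" "q ^ 3 \<noteq> 0"
    using q by (auto intro!: norm_power_less_one)
  define f where "f = (\<lambda>(m::int,n::int). q powi (m\<^sup>2) * (q ^ 3) powi (n\<^sup>2) - (-q) powi (m\<^sup>2) * (-(q ^ 3)) powi (n\<^sup>2))"
  define g where "g = (\<lambda>(k::int,l::int). q powi (k\<^sup>2 + k) * (q ^ 3) powi (l\<^sup>2 + l))"
  have "(f has_sum (phi q * phi (q ^ 3) - phi (-q) * phi (-(q ^ 3)))) UNIV"
    using has_sum_diff[OF has_sum_phi_mult[of q "q ^ 3"] has_sum_phi_mult[of "-q" "-(q ^ 3)"]] q q3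
    unfolding f_def by (simp add: case_prod_unfold)
  hence "phi q * phi (q ^ 3) - phi (-q) * phi (-(q ^ 3))
       = infsum f {p. even (fst p + snd p)} + infsum f {p. \<not> even (fst p + snd p)}"
    by (rule has_sum_split)
  \<comment> \<open>The second product carries the sign \<open>(-1) powi (m + n)\<close>: terms with
    \<open>m + n\<close> even cancel, the others double.\<close>
  also have "infsum f {p. even (fst p + snd p)} = 0"
    by (intro infsum_0) (auto simp: f_def power_int_minus_left)
  also have "infsum f {p. \<not> even (fst p + snd p)} = (\<Sum>\<^sub>\<infinity>(j,n). f (2 * j + 1 - n, n))"
    by (rule infsum_odd)
  also have "\<dots> = (\<Sum>\<^sub>\<infinity>p\<in>{p. \<not> even (fst p + snd p)}. 2 * q * g p)"
  proof (rule infsum_reindex_bij_witness[of _ "\<lambda>(k,l). ((k - l) div 2, (k + l + 1) div 2)" "\<lambda>(j,n). (j + n, n - j - 1)"])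
    fix p :: "int \<times> int"
    obtain j n where p: "p = (j, n)"
      by (cases p)
    have "2 * q * g (j + n, n - j - 1) = 2 * (q powi ((2 * j + 1 - n)\<^sup>2) * (q ^ 3) powi (n\<^sup>2))"
      using q by (simp add: g_def power_int_power flip: power_int_add power_int_add_1')
        (simp add: power2_eq_square algebra_simps)
    also have "\<dots> = f (2 * j + 1 - n, n)"
      by (simp add: f_def power_int_minus_left)
    finally show "2 * q * g (case p of (j, n) \<Rightarrow> (j + n, n - j - 1)) = (case p of (j, n) \<Rightarrow> f (2 * j + 1 - n, n))"
      by (simp add: p)
  qed (auto elim!: oddE simp: algebra_simps)
  also have "\<dots> = 2 * q * infsum g {p. \<not> even (fst p + snd p)}"
    by (rule infsum_cmult_right')
  \<comment> \<open>The reflection of \<open>l\<close> to \<open>-1 - l\<close> exchanges the parity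
    classes, so twice the odd half is the whole sum.\<close>
  also have "\<dots> = q * (infsum g {p. even (fst p + snd p)} + infsum g {p. \<not> even (fst p + snd p)})"
  proof -
    have "infsum g {p. \<not> even (fst p + snd p)} = infsum g {p. even (fst p + snd p)}"
      by (rule infsum_reindex_bij_witness[of _ "\<lambda>(m,n). (m, -1 - n)" "\<lambda>(m,n). (m, -1 - n)"])
         (auto simp: g_def power2_eq_square algebra_simps)
    thus ?thesis
      by simp
  qed
  also have "\<dots> = q * (psi q * psi (q ^ 3))"
    unfolding g_def
    using has_sum_split[OF has_sum_psi_mult[OF q q3], of "\<lambda>p. even (fst p + snd p)"] by simp
  finally show ?thesis
    by simp
qed

text \<open>
  The left-hand side is a sum of \<open>\<plusminus>q\<close> to the power \<open>m\<^sup>2 + 5n\<^sup>2\<close> over \<open>m + n = 2j + 1\<close>, and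
  \<open>T i\<close> is its part with \<open>j\<close> congruent to \<open>i\<close> modulo 3. Multiplication by \<open>1 + \<surd>-5\<close>, of norm 6,
  turns \<open>T 0\<close> into a product of two pentagonal number series; \<open>T 1\<close> cancels under the involution that
  fixes \<open>m - 5n\<close> and negates \<open>m + n\<close>.
\<close>
lemma phi_degree_5:
  assumes q: "norm q < 1" "q \<noteq> 0"
  shows "phi q * phi (-(q ^ 5)) - phi (-q) * phi (q ^ 5) = 4 * q * euler_prod (q ^ 4) * euler_prod (q ^ 20)"
proof -
  have q5: "norm (q ^ 5) < 1" "q ^ 5 \<noteq> 0"
    using q by (auto intro!: norm_power_less_one)
  define g where "g = (\<lambda>(m::int,n::int). q powi (m\<^sup>2) * (-(q ^ 5)) powi (n\<^sup>2) - (-q) powi (m\<^sup>2) * (q ^ 5) powi (n\<^sup>2))"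
  define f where "f = (\<lambda>(j::int,n::int). (-1) powi n * q powi ((2 * j + 1 - n)\<^sup>2 + 5 * n\<^sup>2))"
  define T where "T = (\<lambda>i. infsum f {p. fst p mod 3 = i})"
  have g: "(g has_sum (phi q * phi (-(q ^ 5)) - phi (-q) * phi (q ^ 5))) UNIV"
    using has_sum_diff[OF has_sum_phi_mult[of q "-(q ^ 5)"] has_sum_phi_mult[of "-q" "q ^ 5"]] q q5
    unfolding g_def by (simp add: case_prod_unfold)
  \<comment> \<open>For \<open>m + n\<close> odd, \<open>(-1) powi n\<close> and
    \<open>- ((-1) powi m)\<close> agree, hence the factor 2.\<close>
  have gf: "(\<lambda>(j,n). g (2 * j + 1 - n, n)) = (\<lambda>p. 2 * f p)"
    using q by (auto simp: f_def g_def fun_eq_iff power_int_minus_left power_int_add power_int_power)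
  have "f summable_on UNIV"
  proof -
    have "g summable_on {p. odd (fst p + snd p)}"
      using g by (meson has_sum_imp_summable subset_UNIV summable_on_subset_banach)
    also have "?this \<longleftrightarrow> (\<lambda>(j,n). g (2 * j + 1 - n, n)) summable_on UNIV"
      by (rule summable_on_reindex_bij_witness
           [of _ "\<lambda>(j,n). (2 * j + 1 - n, n)" "\<lambda>(m,n). ((m + n) div 2, n)"])
         (auto elim!: oddE simp: algebra_simps)
    finally show ?thesis
      unfolding gf by (subst (asm) summable_on_cmult_right') auto
  qed
  hence f_sub: "f summable_on B" for B
    by (rule summable_on_subset_banach) auto

  have "phi q * phi (-(q ^ 5)) - phi (-q) * phi (q ^ 5)
      = infsum g {p. even (fst p + snd p)} + infsum g {p. odd (fst p + snd p)}"
    using g by (rule has_sum_split)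
  also have "infsum g {p. even (fst p + snd p)} = 0"
    by (intro infsum_0) (auto simp: g_def power_int_minus_left)
  also have "infsum g {p. odd (fst p + snd p)} = 2 * infsum f UNIV"
    unfolding infsum_odd gf by (rule infsum_cmult_right')
  also have "infsum f UNIV = T 0 + T 1 + T 2"
  proof -
    have "j mod 3 = 0 \<or> j mod 3 = 1 \<or> j mod 3 = 2" for j :: int
      by presburger
    hence "UNIV = ({p::int \<times> int. fst p mod 3 = 0} \<union> {p. fst p mod 3 = 1}) \<union> {p. fst p mod 3 = 2}"
      by auto
    also have "infsum f \<dots> = infsum f ({p. fst p mod 3 = 0} \<union> {p. fst p mod 3 = 1}) + T 2"
      unfolding T_def by (intro infsum_Un_disjoint f_sub) auto
    also have "infsum f ({p. fst p mod 3 = 0} \<union> {p. fst p mod 3 = 1}) = T 0 + T 1"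
      unfolding T_def by (intro infsum_Un_disjoint f_sub) auto
    finally show ?thesis .
  qed
  also have "T 1 = 0"
  proof -
    have "T 1 = (\<Sum>\<^sub>\<infinity>p\<in>{p. fst p mod 3 = 1}. - f p)"
      unfolding T_def
    \<comment> \<open>Fixing \<open>m - 5 * n\<close> and negating \<open>m + n = 2 * j + 1\<close>
      lowers \<open>n\<close> by \<open>(2 * j + 1) / 3\<close>, an odd integer when
      \<open>j mod 3 = 1\<close>, so the sign flips. The exponent is kept because \<open>6 *
      (m\<^sup>2 + 5 * n\<^sup>2) = 5 * (m + n)\<^sup>2 + (m - 5 * n)\<^sup>2\<close>.\<close>
    proof (rule infsum_reindex_bij_witness[of _ "\<lambda>(j,n). (-j-1, n - 2 * (j div 3) - 1)" "\<lambda>(j,n). (-j-1, n - 2 * (j div 3) - 1)"])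
      fix p :: "int \<times> int"
      assume "p \<in> {p. fst p mod 3 = 1}"
      then obtain l n where p: "p = (3 * l + 1, n)"
        by (cases p) (auto, metis mult_div_mod_eq)
      have "(2 * (-(3 * l + 1) - 1) + 1 - (n - 2 * l - 1))\<^sup>2 + 5 * (n - 2 * l - 1)\<^sup>2
          = (2 * (3 * l + 1) + 1 - n)\<^sup>2 + 5 * n\<^sup>2"
        by (simp add: power2_eq_square algebra_simps)
      thus "- f (case p of (j, n) \<Rightarrow> (-j-1, n - 2 * (j div 3) - 1)) = f p"
        by (auto simp: p f_def power_int_minus_left)
      have "(- (3 * l + 1) - 1) div 3 = -l - 1"
        by presburger
      thus "(case case p of (j, n) \<Rightarrow> (-j-1, n - 2 * (j div 3) - 1) of (j, n) \<Rightarrow> (-j-1, n - 2 * (j div 3) - 1)) = p"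
         "(case case p of (j, n) \<Rightarrow> (-j-1, n - 2 * (j div 3) - 1) of (j, n) \<Rightarrow> (-j-1, n - 2 * (j div 3) - 1)) = p"
        by (auto simp: p)
      have "(- (3 * l + 1) - 1) mod 3 = 1"
        by presburger
      thus "(case p of (j, n) \<Rightarrow> (-j-1, n - 2 * (j div 3) - 1)) \<in> {p. fst p mod 3 = 1}"
        "(case p of (j, n) \<Rightarrow> (-j-1, n - 2 * (j div 3) - 1)) \<in> {p. fst p mod 3 = 1}"
        by (auto simp: p)
    qed
    thus ?thesis
      by (simp add: T_def infsum_uminus)
  qed
  also have "T 2 = T 0"
    unfolding T_def
  \<comment> \<open>The point reflection of \<open>(m, n)\<close> to
    \<open>(-m, -n)\<close>.\<close>
  proof (rule infsum_reindex_bij_witness[of _ "\<lambda>(j,n). (-j-1, -n)" "\<lambda>(j,n). (-j-1, -n)"])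
    fix p :: "int \<times> int"
    show "f (case p of (j,n) \<Rightarrow> (-j-1, -n)) = f p"
      by (cases p) (auto simp: f_def power_int_minus_left power2_eq_square algebra_simps)
  next
    have "(- j - 1) mod 3 = 0" if "j mod 3 = 2" for j :: int
      using that by presburger
    thus "(case p of (j,n) \<Rightarrow> (-j-1, -n)) \<in> {p. fst p mod 3 = 0}" if "p \<in> {p. fst p mod 3 = 2}" for p :: "int \<times> int"
      using that by (auto simp: case_prod_unfold)
  next
    have "(- j - 1) mod 3 = 2" if "j mod 3 = 0" for j :: int
      using that by presburger
    thus "(case p of (j,n) \<Rightarrow> (-j-1, -n)) \<in> {p. fst p mod 3 = 2}" if "p \<in> {p. fst p mod 3 = 0}" for p :: "int \<times> int"
      using that by (auto simp: case_prod_unfold)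
  qed auto
  also have "T 0 = q * (euler_prod (q ^ 4) * euler_prod (q ^ 20))"
  proof -
    \<comment> \<open>Here \<open>m = 5 * l + k + 1\<close> and \<open>n = l - k\<close>, so the
      cross terms of \<open>m\<^sup>2 + 5 * n\<^sup>2\<close> cancel.\<close>
    have "T 0 = (\<Sum>\<^sub>\<infinity>(k,l). f (3 * l, l - k))"
      unfolding T_def
      by (rule infsum_reindex_bij_witness[of _ "\<lambda>(k,l). (3 * l, l - k)" "\<lambda>(j,n). (j div 3 - n, j div 3)"]) auto
    also have "(\<lambda>(k,l). f (3 * l, l - k)) = (\<lambda>p. q * (case p of (k,l) \<Rightarrow>
        ((-1) powi k * q powi (6 * k\<^sup>2 + 2 * k)) * ((-1) powi l * (q ^ 5) powi (6 * l\<^sup>2 + 2 * l))))"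
    proof -
      have "q powi ((2 * (3 * l) + 1 - (l - k))\<^sup>2 + 5 * (l - k)\<^sup>2)
          = q * (q powi (6 * k\<^sup>2 + 2 * k) * (q ^ 5) powi (6 * l\<^sup>2 + 2 * l))" for k l
        using q by (simp add: power_int_power flip: power_int_add power_int_add_1')
          (simp add: power2_eq_square algebra_simps)
      thus ?thesis
        by (auto simp: f_def fun_eq_iff power_int_minus_left)
    qed
    also have "infsum \<dots> UNIV = q * (euler_prod (q ^ 4) * euler_prod ((q ^ 5) ^ 4))"
      using has_sum_cmult_right[OF has_sum_times_complex[OF has_sum_euler_prod[OF q] has_sum_euler_prod[OF q5]], of q]
      by (simp add: infsumI)
    finally show ?thesis
      by (simp flip: power_mult)
  qed
  finally show ?thesis
    by simp
qed

section \<open>Modular equations\<close>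

lemma phi_uminus_nonzero:
  assumes "norm q < 1" "q \<noteq> 0"
  shows "phi (-q) \<noteq> 0"
proof -
  have "norm (q\<^sup>2) < 1"
    using assms by (intro norm_power_less_one) auto
  thus ?thesis
    using assms by (simp add: phi_uminus_eq euler_prod_nonzero)
qed

text \<open>By the product formulas, \<open>phi q - phi (-q)\<close> and
  \<open>4 * h q * phi (-q)\<close> both equal
  \<open>4 * q * euler_prod (q ^ 16) ^ 2 / euler_prod (q ^ 8)\<close>.\<close>

lemma phi_eq_h:
  assumes q: "norm q < 1" "q \<noteq> 0"
  shows "phi q = (1 + 4 * h q) * phi (-q)"
proof -
  have q4: "norm (q ^ 4) < 1" "q ^ 4 \<noteq> 0" and q2: "norm (q\<^sup>2) < 1"
    using q by (auto intro!: norm_power_less_one)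
  have "psi (q ^ 4) = 2 * euler_prod (q ^ 16) ^ 2 / euler_prod (q ^ 8)"
    using psi_eq[OF q4] by (simp flip: power_mult)
  moreover have "h q * phi (-q) = q * (euler_prod (q ^ 16) ^ 2 / euler_prod (q ^ 8))"
    using q euler_prod_nonzero[OF q(1)] euler_prod_nonzero[OF q2]
    by (simp add: h_eq phi_uminus_eq field_simps)
  ultimately have "phi q - phi (-q) = 4 * (h q * phi (-q))"
    using phi_minus_phi_uminus[OF q] by simp
  thus ?thesis
    by (simp add: algebra_simps)
qed

text \<open>The fourth power of \<open>phi_psi_degree_3\<close> has right-hand side
  \<open>q ^ 4 * psi q ^ 4 * psi (q ^ 3) ^ 4\<close>, the product of Jacobi's identities at
  \<open>q\<close> and \<open>q ^ 3\<close>.\<close>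

lemma modular_equation_degree_3:
  assumes q: "norm q < 1" "q \<noteq> 0"
  defines "w \<equiv> 1 + 4 * h q" and "v \<equiv> 1 + 4 * h (q ^ 3)"
  shows "(w ^ 4 - 1) * (v ^ 4 - 1) = (w * v - 1) ^ 4"
proof -
  have q3: "norm (q ^ 3) < 1" "q ^ 3 \<noteq> 0"
    using q by (auto intro!: norm_power_less_one)
  define b B where "b = phi (-q)" and "B = phi (-(q ^ 3))"
  have nz: "b \<noteq> 0" "B \<noteq> 0"
    unfolding b_def B_def by (intro phi_uminus_nonzero q q3)+
  have a: "phi q = w * b" "phi (q ^ 3) = v * B"
    unfolding w_def v_def b_def B_def by (intro phi_eq_h q q3)+
  have "b ^ 4 * B ^ 4 * ((w * v - 1) ^ 4) = ((w * b) * (v * B) - b * B) ^ 4"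
    by (simp add: algebra_simps flip: power_mult_distrib)
  also have "\<dots> = (q * psi q ^ 4) * (q ^ 3 * psi (q ^ 3) ^ 4)"
    using phi_psi_degree_3[OF q] unfolding a b_def[symmetric] B_def[symmetric]
    by (simp add: power_mult_distrib) (simp add: power4_eq_xxxx power3_eq_cube)
  also have "\<dots> = ((w * b) ^ 4 - b ^ 4) * ((v * B) ^ 4 - B ^ 4)"
    using phi_fourth_power_diff[OF q] phi_fourth_power_diff[OF q3]
    unfolding a b_def[symmetric] B_def[symmetric] by simp
  also have "\<dots> = b ^ 4 * B ^ 4 * ((w ^ 4 - 1) * (v ^ 4 - 1))"
    by (simp add: algebra_simps power_mult_distrib)
  finally show ?thesis
    using nz by simp
qed

text \<open>The sixth power of \<open>phi_degree_5\<close> is matched by Jacobi's identity and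
  \<open>phi_times_phi_uminus\<close>, each at \<open>q\<close> and \<open>q ^ 5\<close>:
  \<open>e2\<close> and \<open>e10\<close> cancel, leaving \<open>e4 ^ 6 * e20 ^ 6\<close>.\<close>

lemma modular_equation_degree_5:
  assumes q: "norm q < 1" "q \<noteq> 0"
  defines "w \<equiv> 1 + 4 * h q" and "v \<equiv> 1 + 4 * h (q ^ 5)"
  shows "(w - v) ^ 6 = 16 * w * v * (w ^ 4 - 1) * (v ^ 4 - 1)"
proof -
  have q5: "norm (q ^ 5) < 1" "q ^ 5 \<noteq> 0"
    using q by (auto intro!: norm_power_less_one)
  define b B where "b = phi (-q)" and "B = phi (-(q ^ 5))"
  define e2 e4 e10 e20 where "e2 = euler_prod (q\<^sup>2)" and "e4 = euler_prod (q ^ 4)"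
    and "e10 = euler_prod (q ^ 10)" and "e20 = euler_prod (q ^ 20)"
  have e_nz: "e2 \<noteq> 0" "e4 \<noteq> 0" "e10 \<noteq> 0" "e20 \<noteq> 0"
    unfolding e2_def e4_def e10_def e20_def
    by (intro euler_prod_nonzero norm_power_less_one q; simp)+
  have nz: "b \<noteq> 0" "B \<noteq> 0"
    unfolding b_def B_def by (intro phi_uminus_nonzero q q5)+
  have a: "phi q = w * b" "phi (q ^ 5) = v * B"
    unfolding w_def v_def b_def B_def by (intro phi_eq_h q q5)+
  have ab: "(w * b) * b = (e2\<^sup>2 / e4)\<^sup>2" "(v * B) * B = (e10\<^sup>2 / e20)\<^sup>2"
    using phi_times_phi_uminus[OF q] phi_times_phi_uminus[OF q5]
      phi_uminus_eq[of "q\<^sup>2"] phi_uminus_eq[of "(q ^ 5)\<^sup>2"] q q5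
      norm_power_less_one[of q 2] norm_power_less_one[of "q ^ 5" 2]
    unfolding a b_def[symmetric] B_def[symmetric]
    by (simp_all add: e2_def e4_def e10_def e20_def flip: power_mult)
  have t: "(w * b) ^ 4 - b ^ 4 = q * (2 * e4\<^sup>2 / e2) ^ 4" 
          "(v * B) ^ 4 - B ^ 4 = q ^ 5 * (2 * e20\<^sup>2 / e10) ^ 4"
    using phi_fourth_power_diff[OF q] phi_fourth_power_diff[OF q5] psi_eq[OF q] psi_eq[OF q5]
    unfolding a b_def[symmetric] B_def[symmetric] e2_def e4_def e10_def e20_def
    by (simp_all flip: power_mult)
  have "b ^ 6 * B ^ 6 * (w - v) ^ 6 = ((w * b) * B - b * (v * B)) ^ 6"
    by (simp add: algebra_simps flip: power_mult_distrib)
  also have "\<dots> = (4 * q * e4 * e20) ^ 6"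
    using phi_degree_5[OF q] unfolding a b_def[symmetric] B_def[symmetric] e4_def e20_def by simp
  also have "\<dots> = 16 * ((e2\<^sup>2 / e4)\<^sup>2) * ((e10\<^sup>2 / e20)\<^sup>2) * (q * (2 * e4\<^sup>2 / e2) ^ 4) * (q ^ 5 * (2 * e20\<^sup>2 / e10) ^ 4)"
    using e_nz by (simp add: field_simps eval_nat_numeral)
  also have "\<dots> = b ^ 6 * B ^ 6 * (16 * w * v * (w ^ 4 - 1) * (v ^ 4 - 1))"
    unfolding ab[symmetric] t[symmetric] by algebra
  finally show ?thesis
    using nz by simp
qed

theorem theorem5p1:
  fixes q u v3 v5 :: complex
  assumes "norm q < 1"
    and "u = h q" and "v3 = h (q ^ 3)" and "v5 = h (q ^ 5)"
  shows
    "(u^4 + (- 12 * v3 - 48 * v3^2 - 64 * v3^3) * u^3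
         + (- 6 * v3 - 48 * v3^3 - 30 * v3^2) * u^2
         + (- 6 * v3^2 - 12 * v3^3 - v3) * u + v3^4 = 0)
   \<and>
    ((10 * u^2 + 80 * u^4 + 70 * u^5 + u + 40 * u^3) * v5
     + (4096 * u^5 + 640 * u^2 + 70 * u + 5120 * u^4 + 2560 * u^3) * v5^5
     + (6400 * u^4 + 785 * u^2 + 80 * u + 3200 * u^3 + 5120 * u^5) * v5^4
     + (3200 * u^4 + 400 * u^2 + 1620 * u^3 + 40 * u + 2560 * u^5) * v5^3
     + (100 * u^2 + 10 * u + 785 * u^4 + 640 * u^5 + 400 * u^3) * v5^2
     = v5^6 + u^6)"
proof (cases "q = 0")
  \<comment> \<open>The theta lemmas assume \<open>q\<close> nonzero; at \<open>q = 0\<close> all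
    three values of \<open>h\<close> are 0.\<close>
  case True
  thus ?thesis
    using assms by (simp add: h_def)
next
  case False
  have "((1 + 4 * u) ^ 4 - 1) * ((1 + 4 * v3) ^ 4 - 1) = ((1 + 4 * u) * (1 + 4 * v3) - 1) ^ 4"
    using modular_equation_degree_3 assms False by simp
  moreover have "((1 + 4 * u) - (1 + 4 * v5)) ^ 6
      = 16 * (1 + 4 * u) * (1 + 4 * v5) * ((1 + 4 * u) ^ 4 - 1) * ((1 + 4 * v5) ^ 4 - 1)"
    using modular_equation_degree_5 assms False by simp
  ultimately show ?thesis
    by algebra
qed

end
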